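(* There is a constant $K>0$ such that for every Sturmian word $\boldsymbol{u}$ and every integer $n\geq 2$ we have $\mathrm{PL}_{\boldsymbol{u}}(n)\leq K\ln n$.
   Context: A palindrome is a finite word equal to its reversal. The palindromic length $|v|_{\text{pal}}$ of a finite word $v$ is the minimal number $K$ of palindromes $p_1,\dots,p_K$ such that $v=p_1p_2\cdots p_K$. A Sturmian word is an infinite word over a binary alphabet having exactly $n+1$ distinct factors of length $n$ for every $n\geq 0$. For an infinite word $\boldsymbol{u}$, $\mathrm{PL}_{\boldsymbol{u}}:\mathbb{N}\to\mathbb{N}$ is defined by $\mathrm{PL}_{\boldsymbol{u}}(n)=\max\{|v|_{\text{pal}} : v \text{ is a factor of length } n \text{ of } \boldsymbol{u}\}$. *)

theory Defs
  imports Complex_Main "HOL-Library.Omega_Words_Fun"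
begin

definition palindrome :: "'a list \<Rightarrow> bool" where
  "palindrome p \<longleftrightarrow> rev p = p"

definition pal_length :: "'a list \<Rightarrow> nat" where
  "pal_length v = (LEAST k. \<exists>ps. length ps = k \<and> (\<forall>p\<in>set ps. palindrome p) \<and> v = concat ps)"

definition factors :: "'a word \<Rightarrow> nat \<Rightarrow> 'a list set" where
  "factors u n = {v. length v = n \<and> (\<exists>i j. v = u [i \<rightarrow> j])}"

definition sturmian :: "'a word \<Rightarrow> bool" where
  "sturmian u \<longleftrightarrow> (\<exists>A. card A = 2 \<and> range u \<subseteq> A) \<and> (\<forall>n. card (factors u n) = n + 1)"

definition PL :: "'a word \<Rightarrow> nat \<Rightarrow> nat" where
  "PL u n = Max {pal_length v | v. v \<in> factors u n}"

end

theory Submission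
  imports Defs "HOL-Library.Sublist" "HOL-Library.Discrete_Functions"
begin

text \<open>
  The complexity $n+1$ forces an infinite binary word to have at most one right special factor of
  each length, a property inherited by its finite factors.  Let $w$ be a finite word over
  $\{a,b\}$ with this property. Unless $w$ is a power of one letter followed by a power of the
  other, one letter, say $b$, is isolated, so that $w = a^i\, b\, \theta(w')\, a^j$, where $w'$ is
  the word of the lengths of the $a$-blocks and $\theta(k) = a^k b$.  Again $w'$ is binary with at
  most one right special factor of each length, and $2|w'| < |w|$.  If $w' = p_1 p_2 \cdots p_m$
  with palindromes $p_i$, then
  $b\,\theta(w') = (b\,\theta(p_1)) (\theta(p_2) b^{-1}) (b\,\theta(p_3)) (\theta(p_4)b^{-1}) \cdots$
  consists of palindromes, followed by one $b$ if $m$ is even.  Hence halving the length costs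
  at most three palindromes.
\<close>

section \<open>Basic notions: bounded palindromic factorizations and right special factors\<close>

definition pal_factorizable :: "nat \<Rightarrow> 'a list \<Rightarrow> bool" where
  "pal_factorizable n v \<longleftrightarrow> (\<exists>ps. length ps \<le> n \<and> (\<forall>p\<in>set ps. palindrome p) \<and> v = concat ps)"

lemma pal_length_le:
  assumes "pal_factorizable n v"
  shows "pal_length v \<le> n"
proof -
  obtain ps where ps: "length ps \<le> n" "\<forall>p\<in>set ps. palindrome p" "v = concat ps"
    using assms by (auto simp: pal_factorizable_def)
  have "pal_length v \<le> length ps"
    unfolding pal_length_def by (rule Least_le) (use ps in blast)
  with ps show ?thesis by simp
qed

lemma pal_factorizable_append:
  assumes "pal_factorizable m v" "pal_factorizable n w"
  shows "pal_factorizable (m + n) (v @ w)"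
proof -
  obtain ps qs where
    "length ps \<le> m" "\<forall>p\<in>set ps. palindrome p" "v = concat ps"
    "length qs \<le> n" "\<forall>p\<in>set qs. palindrome p" "w = concat qs"
    using assms by (auto simp: pal_factorizable_def)
  then show ?thesis
    unfolding pal_factorizable_def by (intro exI[of _ "ps @ qs"]) auto
qed

lemma pal_factorizable_mono: "pal_factorizable m v \<Longrightarrow> m \<le> n \<Longrightarrow> pal_factorizable n v"
  unfolding pal_factorizable_def using le_trans by blast

lemma pal_factorizable_palindrome: "palindrome p \<Longrightarrow> pal_factorizable (Suc 0) p"
  unfolding pal_factorizable_def by (intro exI[of _ "[p]"]) auto

lemma pal_factorizable_replicate: "pal_factorizable (Suc 0) (replicate i a)"
  by (rule pal_factorizable_palindrome) (simp add: palindrome_def)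

text \<open>Over two letters this says that each length has at most one right special factor. Fixing
  one pair \<open>c\<close>, \<open>d\<close> for both \<open>x\<close> and \<open>y\<close> keeps
  the notion usable for words of block lengths not yet known to be binary.\<close>

definition unique_right_special :: "'a list \<Rightarrow> bool" where
  "unique_right_special w \<longleftrightarrow>
    (\<forall>x y c d. length x = length y \<longrightarrow> c \<noteq> d \<longrightarrow>
      sublist (x @ [c]) w \<longrightarrow> sublist (x @ [d]) w \<longrightarrow>
      sublist (y @ [c]) w \<longrightarrow> sublist (y @ [d]) w \<longrightarrow> x = y)"

lemma unique_right_specialD:
  assumes "unique_right_special w" "length x = length y" "c \<noteq> d"
    "sublist (x @ [c]) w" "sublist (x @ [d]) w" "sublist (y @ [c]) w" "sublist (y @ [d]) w"
  shows "x = y"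
  using assms unfolding unique_right_special_def by blast

section \<open>The block coding \<open>blocks a b\<close>, the map \<theta> of the overview\<close>

definition blocks :: "'a \<Rightarrow> 'a \<Rightarrow> nat list \<Rightarrow> 'a list" where
  "blocks a b ks = concat (map (\<lambda>k. replicate k a @ [b]) ks)"

lemma blocks_Nil [simp]: "blocks a b [] = []"
  and blocks_Cons [simp]: "blocks a b (k # ks) = replicate k a @ b # blocks a b ks"
  and blocks_append [simp]: "blocks a b (ks @ ls) = blocks a b ks @ blocks a b ls"
  by (simp_all add: blocks_def)

text \<open>With the extra leading \<open>b\<close> every \<open>a\<close>-block lies between two
  letters \<open>b\<close>, so reversal only reverses the order of the blocks.\<close>

lemma rev_Cons_blocks: "rev (b # blocks a b ks) = b # blocks a b (rev ks)"
  by (induction ks) auto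

lemma palindrome_Cons_blocks: "palindrome ks \<Longrightarrow> palindrome (b # blocks a b ks)"
  unfolding palindrome_def rev_Cons_blocks by simp

text \<open>Here \<open>q\<close> is the palindrome \<open>b # blocks a b ks\<close> stripped of its
  two outer letters \<open>b\<close>.\<close>

lemma blocks_palindromeE:
  assumes "palindrome ks" "ks \<noteq> []"
  obtains q where "palindrome q" "blocks a b ks = q @ [b]"
proof -
  obtain ls l where "ks = ls @ [l]" using assms(2) by (cases ks rule: rev_cases) auto
  then obtain q where q: "blocks a b ks = q @ [b]" by simp
  have "rev (b # blocks a b ks) = b # blocks a b ks"
    using palindrome_Cons_blocks[OF assms(1)] by (simp only: palindrome_def)
  then have "palindrome q" by (simp add: q palindrome_def)
  with q that show thesis by blast
qed

text \<open>The two claims feed each other: with a leading \<open>b\<close>, the first palindrome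
  uses it up and leaves a word without one; without it, the first palindrome leaves its final
  \<open>b\<close> to the rest. The extra 1 pays for a \<open>b\<close> left over at the
  end.\<close>

lemma pal_factorizable_blocks_concat:
  assumes "\<forall>p\<in>set ps. palindrome p"
  shows "pal_factorizable (length ps + 1) (b # blocks a b (concat ps)) \<and>
         pal_factorizable (length ps + 1) (blocks a b (concat ps))"
  using assms
proof (induction ps)
  case Nil
  show ?case
    using pal_factorizable_palindrome[of "[b]"] pal_factorizable_palindrome[of "[] :: 'a list"]
    by (simp add: palindrome_def)
next
  case (Cons p ps)
  then have p: "palindrome p"
    and IH: "pal_factorizable (length ps + 1) (b # blocks a b (concat ps))"
      "pal_factorizable (length ps + 1) (blocks a b (concat ps))"
    by auto
  have "pal_factorizable (Suc 0) (b # blocks a b p)"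
    by (rule pal_factorizable_palindrome[OF palindrome_Cons_blocks[OF p]])
  from pal_factorizable_append[OF this IH(2)]
  have 1: "pal_factorizable (length (p # ps) + 1) (b # blocks a b (concat (p # ps)))" by simp
  have 2: "pal_factorizable (length (p # ps) + 1) (blocks a b (concat (p # ps)))"
  \<comment> \<open>An empty \<open>p\<close> has no final \<open>b\<close> to hand on to the
    rest.\<close>
  proof (cases "p = []")
    case True
    then show ?thesis using pal_factorizable_mono[OF IH(2)] by simp
  next
    case False
    then obtain q where q: "palindrome q" "blocks a b p = q @ [b]"
      by (rule blocks_palindromeE[OF p])
    from pal_factorizable_append[OF pal_factorizable_palindrome[OF q(1)] IH(1)] show ?thesis
      by (simp add: q(2))
  qed
  from 1 2 show ?case ..
qed

lemma pal_factorizable_Cons_blocks: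
  assumes "pal_factorizable n ks"
  shows "pal_factorizable (n + 1) (b # blocks a b ks)"
proof -
  obtain ps where ps: "length ps \<le> n" "\<forall>p\<in>set ps. palindrome p" "ks = concat ps"
    using assms by (auto simp: pal_factorizable_def)
  from pal_factorizable_blocks_concat[OF ps(2), THEN conjunct1] show ?thesis
    unfolding ps(3) by (rule pal_factorizable_mono) (use ps(1) in simp)
qed

lemma blocks_decomposition:
  assumes "set w \<subseteq> {a, b}"
  shows "\<exists>ks j. w = blocks a b ks @ replicate j a"
  using assms
proof (induction w)
  case Nil
  have "[] = blocks a b [] @ replicate 0 a" by simp
  then show ?case by blast
next
  case (Cons c w)
  then obtain ks j where w: "w = blocks a b ks @ replicate j a" by auto
  consider "c = b" | "c = a" "ks = []" | k ls where "c = a" "ks = k # ls"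
    using Cons.prems by (cases ks) auto
  then show ?case
  proof cases
    case 1
    then have "c # w = blocks a b (0 # ks) @ replicate j a" by (simp add: w)
    then show ?thesis by blast
  next
    case 2
    then have "c # w = blocks a b [] @ replicate (Suc j) a" by (simp add: w)
    then show ?thesis by blast
  next
    case 3
    then have "c # w = blocks a b (Suc k # ls) @ replicate j a" by (simp add: w)
    then show ?thesis by blast
  qed
qed

section \<open>Right special factors under the block coding\<close>

lemma count_list_blocks: "a \<noteq> b \<Longrightarrow> count_list (blocks a b ks) b = length ks"
  by (induction ks) (auto simp: count_list_0_iff)

lemma replicate_append_Cons_inject:
  assumes "a \<noteq> b" "replicate k a @ b # v = replicate l a @ b # w"
  shows "k = l \<and> v = w"
  using assms(2)
proof (induction k arbitrary: l)
  case 0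
  with \<open>a \<noteq> b\<close> show ?case by (cases l) auto
next
  case (Suc k)
  with \<open>a \<noteq> b\<close> show ?case by (cases l) auto
qed

lemma blocks_inject:
  assumes "a \<noteq> b" "blocks a b ks = blocks a b ls"
  shows "ks = ls"
  using assms(2)
proof (induction ks arbitrary: ls)
  case Nil
  then show ?case by (cases ls) auto
next
  case (Cons k ks)
  then obtain l ls' where "ls = l # ls'" by (cases ls) auto
  with Cons replicate_append_Cons_inject[OF assms(1)] show ?case by (metis blocks_Cons)
qed

text \<open>The \<open>b\<close> before the image of \<open>vs\<close> closes the preceding block,
  or is the added leading letter if there is no such block.\<close>

lemma sublist_Cons_blocks:
  assumes "sublist vs ks"
  shows "sublist (b # blocks a b vs) (b # blocks a b ks)"
proof -
  obtain ps ss where ks: "ks = ps @ vs @ ss" using assms by (auto simp: sublist_def)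
  show ?thesis
  proof (cases ps rule: rev_cases)
    case Nil
    then show ?thesis by (auto simp: ks sublist_def intro: exI[of _ "[]"])
  next
    case (snoc ps' p)
    then have "b # blocks a b ks
      = (b # blocks a b ps' @ replicate p a) @ (b # blocks a b vs) @ blocks a b ss"
      by (simp add: ks)
    then show ?thesis unfolding sublist_def by blast
  qed
qed

text \<open>After \<open>k\<close> letters \<open>a\<close>, a block of length \<open>k\<close> ends
  with \<open>b\<close>, while a longer one continues with \<open>a\<close>.\<close>

lemma right_special_blocks:
  assumes "sublist (v @ [k]) ks" "sublist (v @ [l]) ks" "k < l"
  shows "sublist ((b # blocks a b v @ replicate k a) @ [b]) (b # blocks a b ks)"
    and "sublist ((b # blocks a b v @ replicate k a) @ [a]) (b # blocks a b ks)"
proof -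
  show "sublist ((b # blocks a b v @ replicate k a) @ [b]) (b # blocks a b ks)"
    using sublist_Cons_blocks[OF assms(1), of b a] by simp
  obtain m where l: "l = k + Suc m" using assms(3) less_iff_Suc_add by auto
  have "b # blocks a b (v @ [l])
    = ((b # blocks a b v @ replicate k a) @ [a]) @ (replicate m a @ [b])"
    by (simp add: l replicate_add replicate_append_same)
  then have "sublist ((b # blocks a b v @ replicate k a) @ [a]) (b # blocks a b (v @ [l]))"
    by (metis sublist_appendI append_Nil)
  then show "sublist ((b # blocks a b v @ replicate k a) @ [a]) (b # blocks a b ks)"
    using sublist_Cons_blocks[OF assms(2), of b a] by (rule sublist_order.order_trans)
qed

lemma unique_right_special_sublist:
  assumes "unique_right_special w" "sublist v w"
  shows "unique_right_special v"
  using assms sublist_order.order_trans unfolding unique_right_special_def by blast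

lemma sublist_snoc_suffix: "suffix x y \<Longrightarrow> sublist (y @ [c]) w \<Longrightarrow> sublist (x @ [c]) w"
  by (metis sublist_order.order_trans suffix_imp_sublist suffix_def append_assoc)

text \<open>The suffix of \<open>y\<close> of length \<open>length x\<close> is followed by the same
  two letters, so uniqueness makes it \<open>x\<close>.\<close>

lemma right_special_suffix:
  assumes "unique_right_special w" "c \<noteq> d" "length x \<le> length y"
    "sublist (x @ [c]) w" "sublist (x @ [d]) w" "sublist (y @ [c]) w" "sublist (y @ [d]) w"
  shows "suffix x y"
proof -
  define z where "z = drop (length y - length x) y"
  have z: "suffix z y" "length x = length z"
    using assms(3) by (auto simp: z_def suffix_drop)
  have "x = z"
    using unique_right_specialD[OF assms(1) z(2) assms(2,4,5)]
      sublist_snoc_suffix[OF z(1) assms(6)] sublist_snoc_suffix[OF z(1) assms(7)] .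
  with z show ?thesis by simp
qed

text \<open>Both words contain equally many letters \<open>b\<close>, so what precedes the suffix
  contains none; as the longer word starts with \<open>b\<close>, that part is empty.\<close>

lemma blocks_suffix_eq:
  assumes "a \<noteq> b" "length v = length v'"
    "suffix (b # blocks a b v @ replicate k a) (b # blocks a b v' @ replicate k a)"
  shows "v = v'"
proof -
  obtain s where s: "b # blocks a b v' @ replicate k a = s @ b # blocks a b v @ replicate k a"
    using assms(3) by (auto simp: suffix_def)
  then have "count_list (b # blocks a b v' @ replicate k a) b
    = count_list s b + count_list (b # blocks a b v @ replicate k a) b"
    by (simp only: count_list_append)
  then have "count_list s b = 0"
    using assms by (simp add: count_list_blocks)
  with s have "s = []" by (cases s) auto
  with s have "blocks a b v = blocks a b v'" by simp
  with assms(1) show ?thesis by (rule blocks_inject)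
qed

text \<open>Right special words of equal length over the block lengths may have images of different
  lengths. The shorter image is then a suffix of the longer, and counting \<open>b\<close> gives
  equality.\<close>

lemma unique_right_special_blocksD:
  assumes "a \<noteq> b" "unique_right_special (b # blocks a b ks)"
  shows "unique_right_special ks"
proof -
  have le: "x = y"
    if "length x = length y" "k < l"
      and xy: "sublist (x @ [k]) ks" "sublist (x @ [l]) ks"
        "sublist (y @ [k]) ks" "sublist (y @ [l]) ks"
      and len: "length (blocks a b x) \<le> length (blocks a b y)" for x y k l
  proof -
    have "suffix (b # blocks a b x @ replicate k a) (b # blocks a b y @ replicate k a)"
      by (rule right_special_suffix[OF assms(2,1)])
        (use len right_special_blocks xy \<open>k < l\<close> in \<open>auto simp del: append_Cons append_assoc\<close>)
    with assms(1) that(1) show ?thesis by (rule blocks_suffix_eq)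
  qed
  have lt: "x = y"
    if "length x = length y" "k < l"
      and "sublist (x @ [k]) ks" "sublist (x @ [l]) ks"
        "sublist (y @ [k]) ks" "sublist (y @ [l]) ks" for x y k l
    using le[of x y k l] le[of y x k l] that by (metis nat_le_linear)
  show ?thesis
    unfolding unique_right_special_def using lt by (metis nat_neq_iff)
qed

text \<open>For \<open>i < j < l\<close>, both \<open>b\<close> followed by \<open>i\<close> letters
  \<open>a\<close> and \<open>b\<close> followed by \<open>j\<close> letters \<open>a\<close> would
  be right special, but the former is no suffix of the latter.\<close>

lemma no_three_block_lengths:
  assumes "a \<noteq> b" "unique_right_special (b # blocks a b ks)"
    and "i \<in> set ks" "j \<in> set ks" "l \<in> set ks" "i < j"
  shows "\<not> j < l"
proof
  assume "j < l"
  \<comment> \<open>This form matches \<open>right_special_blocks\<close> with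
    \<open>v = []\<close>.\<close>
  have sub: "sublist ([] @ [m]) ks" if "m \<in> set ks" for m
    using that by (auto simp: in_set_conv_decomp sublist_def)
  note i = right_special_blocks[OF sub sub \<open>i < j\<close>, OF assms(3,4), of b a]
  note j = right_special_blocks[OF sub sub \<open>j < l\<close>, OF assms(4,5), of b a]
  have "suffix (b # replicate i a) (b # replicate j a)"
    by (rule right_special_suffix[OF assms(2,1)]) (use i j \<open>i < j\<close> in simp_all)
  then have "suffix (b # replicate i a) (replicate j a)"
    using \<open>i < j\<close> by (auto simp: suffix_Cons dest: arg_cong[of _ _ length])
  then have "b \<in> set (replicate j a)" by (auto dest: set_mono_suffix)
  with assms(1) show False by simp
qed

section \<open>Halving the length by desubstitution\<close>

lemma set_two_values:
  fixes ks :: "nat list"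
  assumes "\<And>i j l. i \<in> set ks \<Longrightarrow> j \<in> set ks \<Longrightarrow> l \<in> set ks \<Longrightarrow> i < j \<Longrightarrow> \<not> j < l"
  shows "\<exists>k l. k \<noteq> l \<and> set ks \<subseteq> {k, l}"
proof (cases "ks = []")
  case True
  then show ?thesis by (auto intro: exI[of _ "Suc 0"])
next
  case False
  define k l where "k = Min (set ks)" and "l = Max (set ks)"
  have "k \<in> set ks" "l \<in> set ks" and bounds: "\<And>j. j \<in> set ks \<Longrightarrow> k \<le> j \<and> j \<le> l"
    using False by (auto simp: k_def l_def)
  then have sub: "set ks \<subseteq> {k, l}"
    using assms[of k _ l] by (metis insertCI le_neq_implies_less subsetI)
  show ?thesis
  proof (cases "k = l")
    case True
    \<comment> \<open>With a single block length, any other number serves as second letter.\<close>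
    with sub have "set ks \<subseteq> {k, Suc k}" by auto
    then show ?thesis by (metis n_not_Suc_n)
  qed (use sub in blast)
qed

lemma not_sublist_pair_split:
  assumes "set w \<subseteq> {a, b}" "\<not> sublist [a, b] w"
  shows "\<exists>i j. w = replicate i b @ replicate j a"
  using assms
proof (induction w)
  case Nil
  show ?case by auto
next
  case (Cons c w)
  then obtain i j where w: "w = replicate i b @ replicate j a"
    by (auto simp: sublist_Cons_right)
  show ?case
  proof (cases "c = b")
    case True
    then have "c # w = replicate (Suc i) b @ replicate j a" by (simp add: w)
    then show ?thesis by blast
  next
    case False
    then have c: "c = a" using Cons.prems by auto
    have "i = 0"
    proof (cases i)
      case (Suc i')
      then have "c # w = [] @ [a, b] @ (replicate i' b @ replicate j a)" by (simp add: c w)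
      then have "sublist [a, b] (c # w)" unfolding sublist_def by blast
      with Cons.prems show ?thesis by simp
    qed
    then have "c # w = replicate 0 b @ replicate (Suc j) a" by (simp add: c w)
    then show ?thesis by blast
  qed
qed

text \<open>A block of length 0 would create \<open>[b, b]\<close>, even as the first block because
  of the leading \<open>b\<close>. So each block contributes at least two letters.\<close>

lemma two_length_le_blocks:
  assumes "\<not> sublist [b, b] (b # blocks a b ks)"
  shows "2 * length ks \<le> length (blocks a b ks)"
proof -
  have pos: "k \<noteq> 0" if "k \<in> set ks" for k
  proof
    assume "k = 0"
    have "sublist [k] ks" using that by (auto simp: in_set_conv_decomp sublist_def)
    from sublist_Cons_blocks[OF this, of b a] \<open>k = 0\<close> assms show False by simp
  qed
  then show ?thesis by (induction ks) (force simp: Suc_le_eq)+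
qed

text \<open>The three extra palindromes are the powers of \<open>a\<close> at both ends and the one
  added by \<open>pal_factorizable_Cons_blocks\<close>.\<close>

lemma isolated_letter_desubstitution:
  assumes "a \<noteq> b" "set w \<subseteq> {a, b}" "unique_right_special w" "\<not> sublist [b, b] w"
    and IH: "\<And>(ks :: nat list) k l. k \<noteq> l \<Longrightarrow> set ks \<subseteq> {k, l} \<Longrightarrow> unique_right_special ks \<Longrightarrow>
      2 * length ks < length w \<Longrightarrow> pal_factorizable n ks"
  shows "pal_factorizable (n + 3) w"
proof -
  obtain ls j where w: "w = blocks a b ls @ replicate j a"
    using blocks_decomposition[OF assms(2)] by blast
  show ?thesis
  proof (cases ls)
    case Nil
    then show ?thesis
      using pal_factorizable_mono[OF pal_factorizable_replicate, of "n + 3"] by (simp add: w)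
  next
    case (Cons i ks)
    \<comment> \<open>The first block is split off because no \<open>b\<close> precedes it; it may
      be incomplete.\<close>
    then have w: "w = replicate i a @ (b # blocks a b ks) @ replicate j a" by (simp add: w)
    then have sub: "sublist (b # blocks a b ks) w" by (auto simp: sublist_def)
    have urs: "unique_right_special (b # blocks a b ks)"
      using assms(3) sub by (rule unique_right_special_sublist)
    have nbb: "\<not> sublist [b, b] (b # blocks a b ks)"
      using assms(4) sub sublist_order.order_trans by blast
    obtain k l where "k \<noteq> l" "set ks \<subseteq> {k, l}"
      using set_two_values[of ks] no_three_block_lengths[OF assms(1) urs] by blast
    \<comment> \<open>Strictness comes from the leading \<open>b\<close>.\<close>
    moreover have "2 * length ks < length w"
      using two_length_le_blocks[OF nbb] by (simp add: w)
    ultimately have "pal_factorizable n ks"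
      using IH unique_right_special_blocksD[OF assms(1) urs] by blast
    from pal_factorizable_append[OF pal_factorizable_replicate
        pal_factorizable_append[OF pal_factorizable_Cons_blocks[OF this]
          pal_factorizable_replicate], of i a b a j a]
    show ?thesis by (simp add: w numeral_3_eq_3)
  qed
qed

text \<open>The words \<open>[a]\<close> and \<open>[b]\<close> cannot both be right special, so
  some two-letter word is missing: a square, which isolates a letter, or a mixed pair, which leaves
  a product of two powers.\<close>

lemma desubstitution_step:
  assumes "a \<noteq> b" "set w \<subseteq> {a, b}" "unique_right_special w"
    and IH: "\<And>(ks :: nat list) k l. k \<noteq> l \<Longrightarrow> set ks \<subseteq> {k, l} \<Longrightarrow> unique_right_special ks \<Longrightarrow>
      2 * length ks < length w \<Longrightarrow> pal_factorizable n ks"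
  shows "pal_factorizable (n + 3) w"
proof -
  have two: "pal_factorizable (n + 3) (replicate i c @ replicate j d)" for i j and c d :: 'a
    using pal_factorizable_append[OF pal_factorizable_replicate pal_factorizable_replicate]
    by (rule pal_factorizable_mono) simp
  have swap: "set w \<subseteq> {b, a}" using assms(2) by blast
  have "\<not> (sublist [a, a] w \<and> sublist [a, b] w \<and> sublist [b, a] w \<and> sublist [b, b] w)"
    using unique_right_specialD[OF assms(3) _ assms(1), of "[a]" "[b]"] assms(1) by auto
  then consider "\<not> sublist [b, b] w" | "\<not> sublist [a, a] w"
    | "\<not> sublist [a, b] w" | "\<not> sublist [b, a] w" by blast
  then show ?thesis
  proof cases
    case 1
    from isolated_letter_desubstitution[OF assms(1-3) 1 IH] show ?thesis .
  next
    case 2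
    from isolated_letter_desubstitution[OF assms(1)[symmetric] swap assms(3) 2 IH]
    show ?thesis .
  next
    case 3
    then show ?thesis using not_sublist_pair_split[OF assms(2)] two by auto
  next
    case 4
    then show ?thesis using not_sublist_pair_split[OF swap] two by auto
  qed
qed

lemma pal_factorizable_nat_list:
  fixes w :: "nat list"
  assumes "a \<noteq> b" "set w \<subseteq> {a, b}" "unique_right_special w" "length w < 2 ^ t"
  shows "pal_factorizable (3 * t) w"
  using assms
proof (induction t arbitrary: w a b)
  case 0
  then show ?case by (auto simp: pal_factorizable_def)
next
  case (Suc t)
  have "pal_factorizable (3 * t + 3) w"
    by (rule desubstitution_step[OF Suc.prems(1-3)], rule Suc.IH) (use Suc.prems(4) in auto)
  then show ?case by (simp add: add.commute)
qed

text \<open>One step leads from an arbitrary alphabet to words over \<open>nat\<close>, where the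
  induction runs; hence the induction hypothesis is a premise of
  \<open>desubstitution_step\<close>.\<close>

lemma pal_factorizable_log:
  assumes "a \<noteq> b" "set w \<subseteq> {a, b}" "unique_right_special w" "length w < 2 ^ Suc t"
  shows "pal_factorizable (3 * t + 3) w"
  by (rule desubstitution_step[OF assms(1-3)], rule pal_factorizable_nat_list)
    (use assms(4) in auto)

section \<open>Factors of Sturmian words and the logarithmic bound\<close>

lemma factors_sublist:
  assumes "sublist v w" "w \<in> factors u n"
  shows "v \<in> factors u (length v)"
proof -
  obtain i j where "w = map u [i..<j]"
    using assms(2) by (auto simp: factors_def subsequence_def)
  moreover obtain ps ss where "w = ps @ v @ ss" using assms(1) by (auto simp: sublist_def)
  ultimately have w: "map u [i..<j] = ps @ v @ ss" by simp
  have "j - i = length ps + length v + length ss"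
    using arg_cong[OF w, of length] by simp
  \<comment> \<open>Subtraction is truncated: for \<open>j < i\<close> the bound fails, but then
    \<open>v\<close> is empty.\<close>
  then have len: "i + length ps + length v \<le> j" if "v \<noteq> []"
    using that by (cases v) auto
  have "v = take (length v) (drop (length ps) (map u [i..<j]))" by (simp add: w)
  also have "\<dots> = map u [i + length ps..<i + length ps + length v]"
    using len by (cases "v = []") (auto simp: drop_map take_map)
  finally show ?thesis unfolding factors_def subsequence_def by blast
qed

lemma factors_extend:
  assumes "x \<in> factors u n"
  shows "\<exists>c. x @ [c] \<in> factors u (Suc n)"
proof -
  obtain i j where x: "length x = n" "x = map u [i..<j]"
    using assms by (auto simp: factors_def subsequence_def)
  show ?thesis
  proof (cases "i \<le> j")
    case True
    then have "x @ [u j] = map u [i..<Suc j]" by (simp add: x)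
    then show ?thesis using x(1) unfolding factors_def subsequence_def by fastforce
  next
    case False
    \<comment> \<open>Here \<open>x\<close> is empty, so any letter of \<open>u\<close> extends
      it.\<close>
    then have "x @ [u j] = map u [j..<Suc j]" by (simp add: x)
    then show ?thesis using x(1) unfolding factors_def subsequence_def by fastforce
  qed
qed

text \<open>Each of the \<open>n + 1\<close> factors of length \<open>n\<close> has an extension.
  Second extensions of both \<open>x\<close> and \<open>y\<close> would give \<open>n + 3\<close>
  factors of length \<open>n + 1\<close>, one too many.\<close>

lemma sturmian_right_special_unique:
  assumes "sturmian u" "c \<noteq> d"
    "x @ [c] \<in> factors u (Suc n)" "x @ [d] \<in> factors u (Suc n)"
    "y @ [c] \<in> factors u (Suc n)" "y @ [d] \<in> factors u (Suc n)"
  shows "x = y"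
proof (rule ccontr)
  assume "x \<noteq> y"
  have card: "card (factors u m) = m + 1" for m using assms(1) by (simp add: sturmian_def)
  then have fin: "finite (factors u m)" for m by (metis Suc_eq_plus1 card.infinite nat.distinct(1))
  obtain e where e: "\<And>z. z \<in> factors u n \<Longrightarrow> z @ [e z] \<in> factors u (Suc n)"
    using factors_extend by metis
  \<comment> \<open>For \<open>x\<close> and \<open>y\<close> both \<open>c\<close> and
    \<open>d\<close> are possible, so \<open>other\<close> picks an extension differing from the one
    chosen by \<open>e\<close>.\<close>
  define other where "other z = (if e z = c then d else c)" for z
  define E where "E = (\<lambda>z. z @ [e z]) ` factors u n"
  have "card E = n + 1"
    unfolding E_def by (subst card_image) (auto simp: inj_on_def card)
  moreover have "finite E" by (simp add: E_def fin)
  moreover have "x @ [other x] \<notin> E" "y @ [other y] \<notin> E"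
    using assms(2) by (auto simp: E_def other_def)
  ultimately have "card (insert (x @ [other x]) (insert (y @ [other y]) E)) = n + 3"
    using \<open>x \<noteq> y\<close> by simp
  moreover have "insert (x @ [other x]) (insert (y @ [other y]) E) \<subseteq> factors u (Suc n)"
    using assms(3-6) e by (auto simp: E_def other_def)
  ultimately have "n + 3 \<le> card (factors u (Suc n))"
    using card_mono[OF fin] by metis
  then show False by (simp add: card)
qed

lemma sturmian_factor_unique_right_special:
  assumes "sturmian u" "w \<in> factors u n"
  shows "unique_right_special w"
  unfolding unique_right_special_def
proof (intro allI impI)
  fix x y :: "'a list" and c d
  assume "length x = length y" and cd: "c \<noteq> d"
    and sub: "sublist (x @ [c]) w" "sublist (x @ [d]) w" "sublist (y @ [c]) w" "sublist (y @ [d]) w"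
  then show "x = y"
    using sturmian_right_special_unique[OF assms(1) cd, of x "length x" y]
      sub[THEN factors_sublist, OF assms(2)] by simp
qed

text \<open>For \<open>n \<ge> 2\<close> both \<open>t\<close> and 1 are at most
  \<open>log 2 n\<close>, so \<open>3 * t + 3\<close> is at most \<open>6 * log 2 n\<close>; this
  gives the constant \<open>6 / ln 2\<close>.\<close>

lemma sturmian_pal_length_le:
  assumes "sturmian u" "n \<ge> 2" "v \<in> factors u n"
  shows "real (pal_length v) \<le> 6 / ln 2 * ln (real n)"
proof -
  obtain a b where ab: "a \<noteq> b" "range u \<subseteq> {a, b}"
    using assms(1) by (auto simp: sturmian_def card_2_iff)
  have v: "set v \<subseteq> {a, b}" "length v = n"
    using assms(3) ab(2) by (fastforce simp: factors_def subsequence_def)+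
  define t where "t = floor_log n"
  have "n < 2 ^ Suc t" using floor_log_exp2_gt[of n] by (simp add: t_def)
  then have "pal_length v \<le> 3 * t + 3"
    using pal_factorizable_log[OF ab(1) v(1)
        sturmian_factor_unique_right_special[OF assms(1,3)]] v(2) pal_length_le by blast
  then have "real (pal_length v) \<le> real (3 * t + 3)" by linarith
  also have "\<dots> \<le> 6 * log 2 (real n)"
  proof -
    have "2 ^ t \<le> n" using floor_log_exp2_le[of n] assms(2) by (simp add: t_def)
    then have "real t \<le> log 2 (real n)" using assms(2) by (simp add: le_log2_of_power)
    moreover have "1 \<le> log 2 (real n)" using assms(2) by simp
    ultimately show ?thesis by simp
  qed
  finally show ?thesis by (simp add: log_def)
qed

theorem theorem4:
  shows "\<exists>K::real. K > 0 \<and>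
    (\<forall>u :: 'a word. sturmian u \<longrightarrow> (\<forall>n::nat. n \<ge> 2 \<longrightarrow> real (PL u n) \<le> K * ln (real n)))"
proof (intro exI[of _ "6 / ln 2"] conjI allI impI)
  show "(6 / ln 2 :: real) > 0" by simp
  fix u :: "'a word" and n :: nat
  assume u: "sturmian u" and n: "n \<ge> 2"
  then have "card (factors u n) = n + 1" by (simp add: sturmian_def)
  \<comment> \<open>Nonzero cardinality yields both facts, so that \<open>Max\<close> is
    attained.\<close>
  then have "finite (factors u n)" "factors u n \<noteq> {}"
    using card.infinite by fastforce+
  then have "PL u n \<in> pal_length ` factors u n"
    unfolding PL_def Setcompr_eq_image by (intro Max_in) auto
  then show "real (PL u n) \<le> 6 / ln 2 * ln (real n)"
    using sturmian_pal_length_le[OF u n] by auto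
qed

end
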